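(* Let $\Gamma$ be a conservative $L$-connection on $M$ with horizontal projector $h$, curvature $\Omega$ and associated almost-complex structure $F$. Let $D$ be the Berwald $L$-lift of $\Gamma$, with curvature tensor $\mathbf R$, and put $R(X,Y)Z=\mathbf R(hX,hY)LZ$ and $P(X,Y)Z=\mathbf R(hX,LY)LZ$. Then for all $X,Y,Z\in\mathfrak X(M)$: (a) $\mathfrak S\,R(X,Y)Z=0$. (b) $\mathfrak S\,(D_{hX}R)(Y,Z)=\mathfrak S\,P(X,F\Omega(Y,Z))$. (c) $(D_{LZ}R)(X,Y)=(D_{hY}P)(X,Z)-(D_{hX}P)(Y,Z)$. (d) $(D_{LZ}P)(X,Y)=(D_{LY}P)(X,Z)$. (e) $P(X,Y)Z=P(Y,X)Z=P(Z,X)Y$ (i.e. $P$ is symmetric in its three variables). Here $\mathfrak S$ denotes the cyclic sum over $X,Y,Z$, and in (b), (c), (d) both sides are endomorphism-valued ($R(X,Y)$ and $P(X,Y)$ being the maps $W\mapsto R(X,Y)W$, $W\mapsto P(X,Y)W$).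
   Context: Everything is $C^\infty$. $M$ is a manifold of dimension $2n$ and $\mathfrak X(M)$ is its Lie algebra of vector fields. A vector $k$-form is a $TM$-valued (skew) $k$-form; a vector $1$-form is a field of endomorphisms of $TM$. Brackets of vector forms are Fr\"olicher--Nijenhuis brackets: for a vector field $X$ and vector $1$-forms $K,N$, $[X,K]Y=[X,KY]-K[X,Y]$, $[K,X]=-[X,K]$, and $$[K,N](X,Y)=[KX,NY]+[NX,KY]+KN[X,Y]+NK[X,Y]-K[NX,Y]-N[KX,Y]-K[X,NY]-N[X,KY].$$ $L$ is a fixed vector $1$-form on $M$ of constant rank $n$ with $[L,L]=0$ and $\mathrm{Im}(L_z)=\mathrm{Ker}(L_z)$ for all $z\in M$ (so $L^2=0$). The vertical bundle is $V(M)=\mathrm{Im}\,L=\mathrm{Ker}\,L$. $C$ denotes the canonical vector field: a fixed vertical vector field on $M$ with $[C,L]=-L$. An $L$-connection on $M$ is a vector $1$-form $\Gamma$ with $L\Gamma=L$ and $\Gamma L=-L$; $v=\frac12(I-\Gamma)$ and $h=\frac12(I+\Gamma)$ are its vertical and horizontal projectors; its curvature is $\Omega=-\frac12[h,h]$; its associated almost-complex structure $F$ is defined by $FL=h$, $Fh=-L$. $\Gamma$ is homogeneous if $[C,\Gamma]=0$. An $L$-spray is a vector field $S$ with $LS=C$ and $[C,S]=S$. A homogeneous $\Gamma$ is conservative if $\Gamma=[L,S]$ for some $L$-spray $S$. A linear connection $D$ on $M$ is $L$-almost-tangent if $D_X(LY)=L(D_XY)$ for all $X,Y$. Put $K(X)=D_XC$.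 $D$ is $L$-regular if it is $L$-almost-tangent and $K$ restricts to an isomorphism $V(M)\to V(M)$, with inverse $\varphi$; the $L$-connection induced by $D$ is then $I-2\varphi\circ K$, and $D$ is reducible if $D\Gamma=0$ for its induced $L$-connection $\Gamma$. $D$ is $L$-normal if it is $L$-almost-tangent and $D_{LX}C=LX$ for all $X$ (then it is $L$-regular). An $L$-lift of $\Gamma$ is an $L$-normal linear connection whose induced $L$-connection is $\Gamma$; it is a reducible $L$-lift if it is moreover reducible. The torsion and curvature of $D$ are $\mathbf T(X,Y)=D_XY-D_YX-[X,Y]$ and $\mathbf R(X,Y)Z=D_XD_YZ-D_YD_XZ-D_{[X,Y]}Z$. The Berwald $L$-lift of a homogeneous $L$-connection $\Gamma$ is the unique reducible $L$-lift of $\Gamma$ with $\mathbf T(LX,Y)=0$ for all $X,Y$ (it exists). Covariant derivatives of tensors $R$, $P$ are the usual ones, e.g. $(D_WR)(X,Y)Z=D_W(R(X,Y)Z)-R(D_WX,Y)Z-R(X,D_WY)Z-R(X,Y)D_WZ$. *)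

theory Defs
  imports "HOL-Analysis.Analysis" "HOL-Library.Function_Algebras"
begin

section \<open>Smooth manifolds, tangent vectors and vector fields\<close>

primrec Ck_on :: "nat \<Rightarrow> 'b::euclidean_space set \<Rightarrow> ('b \<Rightarrow> 'c::real_normed_vector) \<Rightarrow> bool" where
  "Ck_on 0 S f \<longleftrightarrow> continuous_on S f"
| "Ck_on (Suc k) S f \<longleftrightarrow>
     (\<forall>x\<in>S. f differentiable (at x)) \<and> (\<forall>v. Ck_on k S (\<lambda>x. frechet_derivative f (at x) v))"

text \<open>Only used for open \<open>S\<close>, since derivatives are taken in the whole space.\<close>

definition smooth_on :: "'b::euclidean_space set \<Rightarrow> ('b \<Rightarrow> 'c::real_normed_vector) \<Rightarrow> bool" where
  "smooth_on S f \<longleftrightarrow> (\<forall>k. Ck_on k S f)"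

text \<open>The manifold \<open>M\<close> is the whole type \<open>'a\<close> (Hausdorff and second countable), with a smooth
  structure given by a not necessarily maximal atlas of charts \<open>(U, \<phi>)\<close>. The dimension of \<open>M\<close> is
  that of the Euclidean model space \<open>'b\<close>.\<close>

type_synonym ('a, 'b) atlas = "('a set \<times> ('a \<Rightarrow> 'b)) set"

definition smooth_atlas ::
  "('a::{t2_space,second_countable_topology}, 'b::euclidean_space) atlas \<Rightarrow> bool" where
  "smooth_atlas A \<longleftrightarrow>
     (\<forall>(U, \<phi>)\<in>A. open U \<and> open (\<phi> ` U) \<and> homeomorphism U (\<phi> ` U) \<phi> (inv_into U \<phi>)) \<and>
     (\<Union>(U, \<phi>)\<in>A. U) = UNIV \<and>
     (\<forall>(U, \<phi>)\<in>A. \<forall>(V, \<psi>)\<in>A. smooth_on (\<phi> ` (U \<inter> V)) (\<psi> \<circ> inv_into U \<phi>))"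

definition smooth_fun :: "('a, 'b::euclidean_space) atlas \<Rightarrow> ('a \<Rightarrow> real) \<Rightarrow> bool" where
  "smooth_fun A f \<longleftrightarrow> (\<forall>(U, \<phi>)\<in>A. smooth_on (\<phi> ` U) (f \<circ> inv_into U \<phi>))"

text \<open>A tangent vector at \<open>p\<close> is a derivation at \<open>p\<close> of the algebra of smooth functions. It is set
  to 0 on non-smooth functions, so that equality of tangent vectors is equality in HOL.\<close>

type_synonym 'a tvec = "('a \<Rightarrow> real) \<Rightarrow> real"

definition tscale :: "real \<Rightarrow> 'a tvec \<Rightarrow> 'a tvec" where
  "tscale c v = (\<lambda>f. c * v f)"

definition tangent :: "('a, 'b::euclidean_space) atlas \<Rightarrow> 'a \<Rightarrow> 'a tvec set" where
  "tangent A p = {v.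
     (\<forall>f g. smooth_fun A f \<and> smooth_fun A g \<longrightarrow> v (\<lambda>x. f x + g x) = v f + v g) \<and>
     (\<forall>c f. smooth_fun A f \<longrightarrow> v (\<lambda>x. c * f x) = c * v f) \<and>
     (\<forall>f g. smooth_fun A f \<and> smooth_fun A g \<longrightarrow> v (\<lambda>x. f x * g x) = f p * v g + g p * v f) \<and>
     (\<forall>f. \<not> smooth_fun A f \<longrightarrow> v f = 0)}"

type_synonym 'a vfield = "'a \<Rightarrow> 'a tvec"

definition vfact :: "'a vfield \<Rightarrow> ('a \<Rightarrow> real) \<Rightarrow> 'a \<Rightarrow> real" where
  "vfact X f = (\<lambda>p. X p f)"

definition vfields :: "('a, 'b::euclidean_space) atlas \<Rightarrow> 'a vfield set" where
  "vfields A = {X. (\<forall>p. X p \<in> tangent A p) \<and> (\<forall>f. smooth_fun A f \<longrightarrow> smooth_fun A (vfact X f))}"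

definition fscale :: "('a \<Rightarrow> real) \<Rightarrow> 'a vfield \<Rightarrow> 'a vfield" where
  "fscale f X = (\<lambda>p. tscale (f p) (X p))"

definition lie :: "'a vfield \<Rightarrow> 'a vfield \<Rightarrow> 'a vfield" where
  "lie X Y = (\<lambda>p f. X p (vfact Y f) - Y p (vfact X f))"


section \<open>Vector 1-forms and Froelicher--Nijenhuis brackets\<close>

type_synonym 'a vform = "'a \<Rightarrow> 'a tvec \<Rightarrow> 'a tvec"

definition vapp :: "'a vform \<Rightarrow> 'a vfield \<Rightarrow> 'a vfield" where
  "vapp K X = (\<lambda>p. K p (X p))"

text \<open>Only the values of \<open>K p\<close> on \<open>tangent A p\<close> matter. Smoothness of the field of endomorphisms is
  expressed by its sending smooth vector fields to smooth vector fields.\<close>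

definition vforms :: "('a, 'b::euclidean_space) atlas \<Rightarrow> 'a vform set" where
  "vforms A = {K.
     (\<forall>p. \<forall>v\<in>tangent A p. K p v \<in> tangent A p) \<and>
     (\<forall>p. \<forall>v\<in>tangent A p. \<forall>w\<in>tangent A p. K p (v + w) = K p v + K p w) \<and>
     (\<forall>p c. \<forall>v\<in>tangent A p. K p (tscale c v) = tscale c (K p v)) \<and>
     (\<forall>X\<in>vfields A. vapp K X \<in> vfields A)}"

text \<open>\<open>fn01 X K\<close> and \<open>fn10 K X\<close> are the brackets of a vector field with a vector 1-form, and
  \<open>fn11 K N\<close> is the bracket of two vector 1-forms, all given by their values on vector fields.\<close>

definition fn01 :: "'a vfield \<Rightarrow> 'a vform \<Rightarrow> 'a vfield \<Rightarrow> 'a vfield" where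
  "fn01 X K Y = lie X (vapp K Y) - vapp K (lie X Y)"

definition fn10 :: "'a vform \<Rightarrow> 'a vfield \<Rightarrow> 'a vfield \<Rightarrow> 'a vfield" where
  "fn10 K X Y = - fn01 X K Y"

definition fn11 :: "'a vform \<Rightarrow> 'a vform \<Rightarrow> 'a vfield \<Rightarrow> 'a vfield \<Rightarrow> 'a vfield" where
  "fn11 K N X Y =
     lie (vapp K X) (vapp N Y) + lie (vapp N X) (vapp K Y)
     + vapp K (vapp N (lie X Y)) + vapp N (vapp K (lie X Y))
     - vapp K (lie (vapp N X) Y) - vapp N (lie (vapp K X) Y)
     - vapp K (lie X (vapp N Y)) - vapp N (lie X (vapp K Y))"


section \<open>The structure \<open>L\<close>, the canonical field, and \<open>L\<close>-connections\<close>

definition vertical :: "('a, 'b::euclidean_space) atlas \<Rightarrow> 'a vform \<Rightarrow> 'a \<Rightarrow> 'a tvec set" where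
  "vertical A L p = L p ` tangent A p"

definition L_structure :: "('a, 'b::euclidean_space) atlas \<Rightarrow> nat \<Rightarrow> 'a vform \<Rightarrow> bool" where
  "L_structure A n L \<longleftrightarrow>
     L \<in> vforms A \<and>
     (\<forall>p. vector_space.dim tscale (L p ` tangent A p) = n) \<and>
     (\<forall>X\<in>vfields A. \<forall>Y\<in>vfields A. fn11 L L X Y = 0) \<and>
     (\<forall>p. L p ` tangent A p = {v \<in> tangent A p. L p v = 0})"

definition canonical_field ::
  "('a, 'b::euclidean_space) atlas \<Rightarrow> 'a vform \<Rightarrow> 'a vfield \<Rightarrow> bool" where
  "canonical_field A L C \<longleftrightarrow>
     C \<in> vfields A \<and> (\<forall>p. C p \<in> vertical A L p) \<and> (\<forall>Y\<in>vfields A. fn01 C L Y = - vapp L Y)"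

definition L_connection ::
  "('a, 'b::euclidean_space) atlas \<Rightarrow> 'a vform \<Rightarrow> 'a vform \<Rightarrow> bool" where
  "L_connection A L \<Gamma> \<longleftrightarrow>
     \<Gamma> \<in> vforms A \<and>
     (\<forall>p. \<forall>v\<in>tangent A p. L p (\<Gamma> p v) = L p v \<and> \<Gamma> p (L p v) = - L p v)"

definition hproj :: "'a vform \<Rightarrow> 'a vform" where
  "hproj \<Gamma> = (\<lambda>p v. tscale (1/2) (v + \<Gamma> p v))"

definition conn_curvature :: "'a vform \<Rightarrow> 'a vfield \<Rightarrow> 'a vfield \<Rightarrow> 'a vfield" where
  "conn_curvature \<Gamma> X Y = fscale (\<lambda>_. - 1/2) (fn11 (hproj \<Gamma>) (hproj \<Gamma>) X Y)"

definition associated_acs ::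
  "('a, 'b::euclidean_space) atlas \<Rightarrow> 'a vform \<Rightarrow> 'a vform \<Rightarrow> 'a vform \<Rightarrow> bool" where
  "associated_acs A L \<Gamma> F \<longleftrightarrow>
     F \<in> vforms A \<and>
     (\<forall>p. \<forall>v\<in>tangent A p. F p (L p v) = hproj \<Gamma> p v \<and> F p (hproj \<Gamma> p v) = - L p v)"

definition homogeneous ::
  "('a, 'b::euclidean_space) atlas \<Rightarrow> 'a vfield \<Rightarrow> 'a vform \<Rightarrow> bool" where
  "homogeneous A C \<Gamma> \<longleftrightarrow> (\<forall>Y\<in>vfields A. fn01 C \<Gamma> Y = 0)"

definition L_spray ::
  "('a, 'b::euclidean_space) atlas \<Rightarrow> 'a vform \<Rightarrow> 'a vfield \<Rightarrow> 'a vfield \<Rightarrow> bool" where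
  "L_spray A L C S \<longleftrightarrow> S \<in> vfields A \<and> vapp L S = C \<and> lie C S = S"

definition conservative ::
  "('a, 'b::euclidean_space) atlas \<Rightarrow> 'a vform \<Rightarrow> 'a vfield \<Rightarrow> 'a vform \<Rightarrow> bool" where
  "conservative A L C \<Gamma> \<longleftrightarrow>
     L_connection A L \<Gamma> \<and> homogeneous A C \<Gamma> \<and>
     (\<exists>S. L_spray A L C S \<and> (\<forall>Y\<in>vfields A. vapp \<Gamma> Y = fn10 L S Y))"


section \<open>Linear connections and \<open>L\<close>-lifts\<close>

type_synonym 'a lconn = "'a vfield \<Rightarrow> 'a vfield \<Rightarrow> 'a vfield"

definition linear_connection :: "('a, 'b::euclidean_space) atlas \<Rightarrow> 'a lconn \<Rightarrow> bool" where
  "linear_connection A D \<longleftrightarrow>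
     (\<forall>X\<in>vfields A. \<forall>Y\<in>vfields A. D X Y \<in> vfields A) \<and>
     (\<forall>X\<in>vfields A. \<forall>Y\<in>vfields A. \<forall>Z\<in>vfields A.
        D (X + Y) Z = D X Z + D Y Z \<and> D X (Y + Z) = D X Y + D X Z) \<and>
     (\<forall>f. smooth_fun A f \<longrightarrow> (\<forall>X\<in>vfields A. \<forall>Y\<in>vfields A.
        D (fscale f X) Y = fscale f (D X Y) \<and>
        D X (fscale f Y) = fscale (vfact X f) Y + fscale f (D X Y)))"

definition torsion :: "'a lconn \<Rightarrow> 'a vfield \<Rightarrow> 'a vfield \<Rightarrow> 'a vfield" where
  "torsion D X Y = D X Y - D Y X - lie X Y"

definition curvature :: "'a lconn \<Rightarrow> 'a vfield \<Rightarrow> 'a vfield \<Rightarrow> 'a vfield \<Rightarrow> 'a vfield" where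
  "curvature D X Y Z = D X (D Y Z) - D Y (D X Z) - D (lie X Y) Z"

definition L_almost_tangent ::
  "('a, 'b::euclidean_space) atlas \<Rightarrow> 'a vform \<Rightarrow> 'a lconn \<Rightarrow> bool" where
  "L_almost_tangent A L D \<longleftrightarrow>
     linear_connection A D \<and> (\<forall>X\<in>vfields A. \<forall>Y\<in>vfields A. D X (vapp L Y) = vapp L (D X Y))"

text \<open>\<open>DC_form A C D K\<close> says that \<open>K\<close> is the vector 1-form \<open>X \<mapsto> D\<^sub>X C\<close>. It exists, and is unique on
  tangent vectors, because \<open>D\<^sub>X C\<close> is tensorial in \<open>X\<close>.\<close>

definition DC_form ::
  "('a, 'b::euclidean_space) atlas \<Rightarrow> 'a vfield \<Rightarrow> 'a lconn \<Rightarrow> 'a vform \<Rightarrow> bool" where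
  "DC_form A C D K \<longleftrightarrow> K \<in> vforms A \<and> (\<forall>X\<in>vfields A. vapp K X = D X C)"

definition L_regular ::
  "('a, 'b::euclidean_space) atlas \<Rightarrow> 'a vform \<Rightarrow> 'a vfield \<Rightarrow> 'a lconn \<Rightarrow> bool" where
  "L_regular A L C D \<longleftrightarrow>
     L_almost_tangent A L D \<and>
     (\<exists>K. DC_form A C D K \<and> (\<forall>p. bij_betw (K p) (vertical A L p) (vertical A L p)))"

text \<open>\<open>\<Gamma> = I - 2 \<phi> K\<close>, where \<open>\<phi>\<close> is the inverse of the restriction of \<open>K\<close> to the vertical bundle.\<close>

definition induces ::
  "('a, 'b::euclidean_space) atlas \<Rightarrow> 'a vform \<Rightarrow> 'a vfield \<Rightarrow> 'a lconn \<Rightarrow> 'a vform \<Rightarrow> bool" where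
  "induces A L C D \<Gamma> \<longleftrightarrow>
     L_regular A L C D \<and>
     (\<exists>K. DC_form A C D K \<and>
       (\<forall>p. \<forall>v\<in>tangent A p. \<Gamma> p v = v - tscale 2 (inv_into (vertical A L p) (K p) (K p v))))"

definition L_normal ::
  "('a, 'b::euclidean_space) atlas \<Rightarrow> 'a vform \<Rightarrow> 'a vfield \<Rightarrow> 'a lconn \<Rightarrow> bool" where
  "L_normal A L C D \<longleftrightarrow>
     L_almost_tangent A L D \<and> (\<forall>X\<in>vfields A. D (vapp L X) C = vapp L X)"

definition L_lift ::
  "('a, 'b::euclidean_space) atlas \<Rightarrow> 'a vform \<Rightarrow> 'a vfield \<Rightarrow> 'a vform \<Rightarrow> 'a lconn \<Rightarrow> bool" where
  "L_lift A L C \<Gamma> D \<longleftrightarrow> L_normal A L C D \<and> induces A L C D \<Gamma>"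

definition reducible_L_lift ::
  "('a, 'b::euclidean_space) atlas \<Rightarrow> 'a vform \<Rightarrow> 'a vfield \<Rightarrow> 'a vform \<Rightarrow> 'a lconn \<Rightarrow> bool" where
  "reducible_L_lift A L C \<Gamma> D \<longleftrightarrow>
     L_lift A L C \<Gamma> D \<and>
     (\<forall>X\<in>vfields A. \<forall>Y\<in>vfields A. D X (vapp \<Gamma> Y) - vapp \<Gamma> (D X Y) = 0)"

definition berwald_lift ::
  "('a, 'b::euclidean_space) atlas \<Rightarrow> 'a vform \<Rightarrow> 'a vfield \<Rightarrow> 'a vform \<Rightarrow> 'a lconn \<Rightarrow> bool" where
  "berwald_lift A L C \<Gamma> D \<longleftrightarrow>
     reducible_L_lift A L C \<Gamma> D \<and>
     (\<forall>X\<in>vfields A. \<forall>Y\<in>vfields A. torsion D (vapp L X) Y = 0)"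

definition R_tensor ::
  "'a vform \<Rightarrow> 'a vform \<Rightarrow> 'a lconn \<Rightarrow> 'a vfield \<Rightarrow> 'a vfield \<Rightarrow> 'a vfield \<Rightarrow> 'a vfield" where
  "R_tensor L \<Gamma> D X Y Z =
     curvature D (vapp (hproj \<Gamma>) X) (vapp (hproj \<Gamma>) Y) (vapp L Z)"

definition P_tensor ::
  "'a vform \<Rightarrow> 'a vform \<Rightarrow> 'a lconn \<Rightarrow> 'a vfield \<Rightarrow> 'a vfield \<Rightarrow> 'a vfield \<Rightarrow> 'a vfield" where
  "P_tensor L \<Gamma> D X Y Z =
     curvature D (vapp (hproj \<Gamma>) X) (vapp L Y) (vapp L Z)"

definition cov_deriv ::
  "'a lconn \<Rightarrow> 'a vfield \<Rightarrow> ('a vfield \<Rightarrow> 'a vfield \<Rightarrow> 'a vfield \<Rightarrow> 'a vfield) \<Rightarrow>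
    'a vfield \<Rightarrow> 'a vfield \<Rightarrow> 'a vfield \<Rightarrow> 'a vfield" where
  "cov_deriv D W T X Y Z = D W (T X Y Z) - T (D W X) Y Z - T X (D W Y) Z - T X Y (D W Z)"

end

theory Submission
  imports Defs
begin

text \<open>The Berwald lift \<open>D\<close> commutes with \<open>L\<close> and \<open>h\<close>, and its torsion \<open>T\<close> vanishes as soon as one
  argument is vertical. Since \<open>\<Gamma> = [L, S]\<close> and \<open>[L, L] = 0\<close>, the Jacobi identity gives
  \<open>[L, \<Gamma>] = 0\<close>, which says that \<open>T(hX, hY)\<close> is vertical; its vertical part is \<open>\<Omega>(X, Y)\<close>.
  Hence \<open>T(T(X, Y), Z) = 0\<close> and the covariant derivatives of \<open>T\<close> are vertical, so that applying \<open>L\<close>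
  to the first Bianchi identity at \<open>(hX, hY, hZ)\<close> and at \<open>(hX, hZ, LY)\<close> yields (a) and
  \<open>P(X, Y)Z = P(Z, Y)X\<close>. At \<open>(hX, LY, LZ)\<close> its horizontal part shows that the curvature of \<open>D\<close>
  vanishes on two vertical arguments, and its vertical part that \<open>P(X, Y)Z = P(X, Z)Y\<close>. The second
  Bianchi identity at \<open>(hX, hY, hZ)\<close>, \<open>(hX, hY, LZ)\<close> and \<open>(hX, LY, LZ)\<close> is (b), (c) and (d).\<close>

section \<open>The Lie algebra of vector fields\<close>

text \<open>On an open set, functions that agree have the same derivative at every point. Hence sum
  and product rules proved only at points of \<open>S\<close> can be substituted in the recursive
  definition of \<open>Ck_on\<close>.\<close>

lemma Ck_on_cong:
  assumes "open S" and "\<And>x. x \<in> S \<Longrightarrow> f x = g x" and "Ck_on k S f"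
  shows "Ck_on k S g"
  using assms(2,3)
proof (induction k arbitrary: f g)
  case 0
  then show ?case by (simp cong: continuous_on_cong)
next
  case (Suc k)
  have d: "(g has_derivative frechet_derivative f (at x)) (at x)" if "x \<in> S" for x
    using Suc.prems that has_derivative_transform_within_open[OF _ \<open>open S\<close> that, of f _ UNIV g]
    by (auto simp: frechet_derivative_works)
  have "frechet_derivative f (at x) = frechet_derivative g (at x)" if "x \<in> S" for x
    using d[OF that] frechet_derivative_at by blast
  then have "Ck_on k S (\<lambda>x. frechet_derivative g (at x) v)" for v
    using Suc.prems(2) by (auto intro: Suc.IH[of "\<lambda>x. frechet_derivative f (at x) v"])
  then show ?case
    using d by (auto simp: differentiable_def)
qed

lemma Ck_on_Suc_imp: "Ck_on (Suc k) S f \<Longrightarrow> Ck_on k S f"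
proof (induction k arbitrary: f)
  case 0
  then show ?case
    by (auto intro!: continuous_at_imp_continuous_on differentiable_imp_continuous_within)
next
  case (Suc k)
  then show ?case by (metis Ck_on.simps(2))
qed

lemma Ck_on_const: "Ck_on k S (\<lambda>_. c)"
  by (induction k arbitrary: c) simp_all

lemma Ck_on_add:
  assumes "open S" "Ck_on k S f" "Ck_on k S g"
  shows "Ck_on k S (\<lambda>x. f x + g x)"
  using assms(2,3)
proof (induction k arbitrary: f g)
  case 0
  then show ?case by (simp add: continuous_on_add)
next
  case (Suc k)
  have deriv: "frechet_derivative (\<lambda>x. f x + g x) (at x)
      = (\<lambda>v. frechet_derivative f (at x) v + frechet_derivative g (at x) v)"
    if "x \<in> S" for x
    using Suc.prems that
    by (intro frechet_derivative_at[symmetric] has_derivative_add)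
      (auto simp: frechet_derivative_works)
  have "Ck_on k S (\<lambda>x. frechet_derivative (\<lambda>x. f x + g x) (at x) v)" for v
    by (rule Ck_on_cong[OF \<open>open S\<close> _ Suc.IH[of "\<lambda>x. frechet_derivative f (at x) v"
          "\<lambda>x. frechet_derivative g (at x) v"]])
      (use Suc.prems deriv in auto)
  then show ?case using Suc.prems by auto
qed

lemma Ck_on_mult:
  fixes f g :: "'b::euclidean_space \<Rightarrow> real"
  assumes "open S" "Ck_on k S f" "Ck_on k S g"
  shows "Ck_on k S (\<lambda>x. f x * g x)"
  using assms(2,3)
proof (induction k arbitrary: f g)
  case 0
  then show ?case by (simp add: continuous_on_mult)
next
  case (Suc k)
  have deriv: "frechet_derivative (\<lambda>x. f x * g x) (at x)
      = (\<lambda>v. f x * frechet_derivative g (at x) v + frechet_derivative f (at x) v * g x)"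
    if "x \<in> S" for x
    using Suc.prems that
    by (intro frechet_derivative_at[symmetric] has_derivative_mult)
      (auto simp: frechet_derivative_works)
  have "Ck_on k S (\<lambda>x. frechet_derivative (\<lambda>x. f x * g x) (at x) v)" for v
    by (rule Ck_on_cong[OF \<open>open S\<close> _ Ck_on_add[OF \<open>open S\<close>
          Suc.IH[of f "\<lambda>x. frechet_derivative g (at x) v"]
          Suc.IH[of "\<lambda>x. frechet_derivative f (at x) v" g]]])
      (use Suc.prems deriv Ck_on_Suc_imp[of k S] in auto)
  then show ?case using Suc.prems by auto
qed

text \<open>The projector \<open>h\<close> carries a factor 1/2 and \<open>fn11 L L\<close> produces
  every term twice. Proving identities in doubled form avoids scalar multiplication of
  fields.\<close>

lemma vfield_double_cancel:
  fixes X Y :: "'a vfield"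
  assumes "X + X = Y + Y"
  shows "X = Y"
proof (intro ext)
  fix p f
  have "(X + X) p f = (Y + Y) p f" by (simp only: assms)
  then show "X p f = Y p f" by simp
qed

lemma lie_swap: "lie Y X = - lie X Y"
  by (simp add: lie_def fun_eq_iff)

lemma vfact_lie: "vfact (lie X Y) f = (\<lambda>p. vfact X (vfact Y f) p - vfact Y (vfact X f) p)"
  by (simp add: vfact_def lie_def)

lemma vfact_add_left: "vfact (X + Y) f = (\<lambda>p. vfact X f p + vfact Y f p)"
  by (simp add: vfact_def)

lemma vfield_eqI: "(\<And>f. vfact X f = vfact Y f) \<Longrightarrow> X = Y"
  by (simp add: vfact_def fun_eq_iff)

section \<open>Tangent vectors as derivations\<close>

context
  fixes A :: "('a::{t2_space,second_countable_topology}, 'b::euclidean_space) atlas"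
  fixes p :: 'a and v :: "'a tvec"
  assumes v: "v \<in> tangent A p"
begin

lemma tangent_add_fun: "smooth_fun A f \<Longrightarrow> smooth_fun A g \<Longrightarrow> v (\<lambda>x. f x + g x) = v f + v g"
  and tangent_cmult_fun: "smooth_fun A f \<Longrightarrow> v (\<lambda>x. c * f x) = c * v f"
  and tangent_mult_fun:
    "smooth_fun A f \<Longrightarrow> smooth_fun A g \<Longrightarrow> v (\<lambda>x. f x * g x) = f p * v g + g p * v f"
  and tangent_nonsmooth: "\<not> smooth_fun A f \<Longrightarrow> v f = 0"
  using v by (auto simp: tangent_def)

lemma tangent_add: "w \<in> tangent A p \<Longrightarrow> v + w \<in> tangent A p"
  using v by (auto simp: tangent_def algebra_simps)

lemma tangent_tscale: "tscale c v \<in> tangent A p"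
  using v by (auto simp: tangent_def tscale_def algebra_simps)

end

lemma zero_tangent: "0 \<in> tangent A p"
  by (simp add: tangent_def)

section \<open>Smooth functions and vector fields on the manifold\<close>

locale smooth_manifold =
  fixes A :: "('a::{t2_space,second_countable_topology}, 'b::euclidean_space) atlas"
  assumes atlas: "smooth_atlas A"
begin

lemma chart_image_open: "(U, \<phi>) \<in> A \<Longrightarrow> open (\<phi> ` U)"
  using atlas by (auto simp: smooth_atlas_def)

lemma smooth_fun_const: "smooth_fun A (\<lambda>_. c)"
  by (auto simp: smooth_fun_def smooth_on_def o_def Ck_on_const)

lemma smooth_fun_add: "smooth_fun A f \<Longrightarrow> smooth_fun A g \<Longrightarrow> smooth_fun A (\<lambda>x. f x + g x)"
  unfolding smooth_fun_def smooth_on_def o_def using chart_image_open Ck_on_add by blast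

lemma smooth_fun_mult: "smooth_fun A f \<Longrightarrow> smooth_fun A g \<Longrightarrow> smooth_fun A (\<lambda>x. f x * g x)"
  unfolding smooth_fun_def smooth_on_def o_def using chart_image_open Ck_on_mult by blast

lemma smooth_fun_diff: "smooth_fun A f \<Longrightarrow> smooth_fun A g \<Longrightarrow> smooth_fun A (\<lambda>x. f x - g x)"
  using smooth_fun_add[OF _ smooth_fun_mult[OF smooth_fun_const], of f g "- 1"] by simp

lemma tangent_diff_fun:
  assumes "v \<in> tangent A p" "smooth_fun A f" "smooth_fun A g"
  shows "v (\<lambda>x. f x - g x) = v f - v g"
  using tangent_add_fun[OF assms(1,2), of "\<lambda>x. - 1 * g x"] tangent_cmult_fun[OF assms(1,3), of "- 1"]
    smooth_fun_mult[OF smooth_fun_const assms(3), of "- 1"] by simp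

lemma vfields_tangent: "X \<in> vfields A \<Longrightarrow> X p \<in> tangent A p"
  by (simp add: vfields_def)

text \<open>Tangent vectors are 0 on non-smooth functions, so \<open>f\<close> may be arbitrary:
  either the defining property of a field applies or \<open>vfact X f\<close> is constantly 0.
  Bracket identities can thus be checked on all functions.\<close>

lemma smooth_vfact:
  assumes "X \<in> vfields A"
  shows "smooth_fun A (vfact X f)"
proof (cases "smooth_fun A f")
  case True
  then show ?thesis using assms by (simp add: vfields_def)
next
  case False
  then have "vfact X f = (\<lambda>_. 0)"
    using tangent_nonsmooth[OF vfields_tangent[OF assms]] by (auto simp: vfact_def)
  then show ?thesis by (simp add: smooth_fun_const)
qed

lemma vfields_zero: "0 \<in> vfields A"
  by (simp add: vfields_def zero_tangent vfact_def smooth_fun_const)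

lemma vfields_add: "X \<in> vfields A \<Longrightarrow> Y \<in> vfields A \<Longrightarrow> X + Y \<in> vfields A"
  using smooth_fun_add[OF smooth_vfact smooth_vfact]
  by (auto simp: vfields_def tangent_add vfact_def)

lemma vfields_scale: "X \<in> vfields A \<Longrightarrow> fscale (\<lambda>_. c) X \<in> vfields A"
  using smooth_fun_mult[OF smooth_fun_const smooth_vfact]
  by (auto simp: vfields_def tangent_tscale vfact_def fscale_def) (simp add: tscale_def)

lemma vfields_uminus: "X \<in> vfields A \<Longrightarrow> - X \<in> vfields A"
proof -
  have "- X = fscale (\<lambda>_. - 1) X" by (simp add: fscale_def tscale_def fun_eq_iff)
  then show "X \<in> vfields A \<Longrightarrow> - X \<in> vfields A" by (simp add: vfields_scale)
qed

lemma vfields_diff: "X \<in> vfields A \<Longrightarrow> Y \<in> vfields A \<Longrightarrow> X - Y \<in> vfields A"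
  using vfields_add[OF _ vfields_uminus, of X Y] by simp

lemma vfact_add:
  "X \<in> vfields A \<Longrightarrow> smooth_fun A f \<Longrightarrow> smooth_fun A g \<Longrightarrow>
    vfact X (\<lambda>x. f x + g x) = (\<lambda>p. vfact X f p + vfact X g p)"
  and vfact_cmult:
  "X \<in> vfields A \<Longrightarrow> smooth_fun A f \<Longrightarrow> vfact X (\<lambda>x. c * f x) = (\<lambda>p. c * vfact X f p)"
  and vfact_mult:
  "X \<in> vfields A \<Longrightarrow> smooth_fun A f \<Longrightarrow> smooth_fun A g \<Longrightarrow>
    vfact X (\<lambda>x. f x * g x) = (\<lambda>p. f p * vfact X g p + g p * vfact X f p)"
  and vfact_diff:
  "X \<in> vfields A \<Longrightarrow> smooth_fun A f \<Longrightarrow> smooth_fun A g \<Longrightarrow>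
    vfact X (\<lambda>x. f x - g x) = (\<lambda>p. vfact X f p - vfact X g p)"
  by (simp_all add: vfact_def fun_eq_iff tangent_add_fun[OF vfields_tangent]
      tangent_cmult_fun[OF vfields_tangent] tangent_mult_fun[OF vfields_tangent]
      tangent_diff_fun[OF vfields_tangent])

lemma vfact_nonsmooth: "X \<in> vfields A \<Longrightarrow> \<not> smooth_fun A f \<Longrightarrow> vfact X f = (\<lambda>_. 0)"
  using tangent_nonsmooth[OF vfields_tangent] by (auto simp: vfact_def)

lemma vfact_zero: "X \<in> vfields A \<Longrightarrow> vfact X (\<lambda>_. 0) = (\<lambda>_. 0)"
  using vfact_cmult[OF _ smooth_fun_const, of X 0] by simp

text \<open>The mixed products of first derivatives in the Leibniz rule for two successive fields
  are symmetric in \<open>X\<close> and \<open>Y\<close>, so they cancel in the commutator.\<close>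

lemma lie_closed:
  assumes X: "X \<in> vfields A" and Y: "Y \<in> vfields A"
  shows "lie X Y \<in> vfields A"
proof -
  have eq: "lie X Y p f = vfact (lie X Y) f p" for p f
    by (simp add: vfact_def)
  note S = smooth_vfact[OF X] smooth_vfact[OF Y]
  have "lie X Y p \<in> tangent A p" for p
    unfolding tangent_def mem_Collect_eq eq vfact_lie
  proof (intro conjI allI impI; (elim conjE)?)
    fix f g assume f: "smooth_fun A f" and g: "smooth_fun A g"
    show "vfact X (vfact Y (\<lambda>x. f x + g x)) p - vfact Y (vfact X (\<lambda>x. f x + g x)) p
        = vfact X (vfact Y f) p - vfact Y (vfact X f) p
          + (vfact X (vfact Y g) p - vfact Y (vfact X g) p)"
      by (simp add: vfact_add X Y f g S)
    show "vfact X (vfact Y (\<lambda>x. f x * g x)) p - vfact Y (vfact X (\<lambda>x. f x * g x)) p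
        = f p * (vfact X (vfact Y g) p - vfact Y (vfact X g) p)
          + g p * (vfact X (vfact Y f) p - vfact Y (vfact X f) p)"
      by (simp add: vfact_add vfact_mult X Y f g S smooth_fun_mult) (simp add: algebra_simps)
  next
    fix c f assume f: "smooth_fun A f"
    show "vfact X (vfact Y (\<lambda>x. c * f x)) p - vfact Y (vfact X (\<lambda>x. c * f x)) p
        = c * (vfact X (vfact Y f) p - vfact Y (vfact X f) p)"
      by (simp add: vfact_cmult X Y f S algebra_simps)
  next
    fix f assume f: "\<not> smooth_fun A f"
    show "vfact X (vfact Y f) p - vfact Y (vfact X f) p = 0"
      by (simp add: vfact_nonsmooth[OF _ f] vfact_zero X Y)
  qed
  moreover have "smooth_fun A (vfact (lie X Y) f)" for f
    unfolding vfact_lie by (intro smooth_fun_diff S)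
  ultimately show ?thesis by (simp add: vfields_def)
qed

lemma lie_add_left:
  assumes "X \<in> vfields A" "Y \<in> vfields A" "Z \<in> vfields A"
  shows "lie (X + Y) Z = lie X Z + lie Y Z"
  using assms
  by (simp add: lie_def fun_eq_iff vfact_add_left tangent_add_fun[OF vfields_tangent] smooth_vfact)

lemma lie_add_right:
  assumes "X \<in> vfields A" "Y \<in> vfields A" "Z \<in> vfields A"
  shows "lie X (Y + Z) = lie X Y + lie X Z"
  using lie_add_left[OF assms(2,3,1)] lie_swap[of X] by simp

lemma lie_Jacobi:
  assumes X: "X \<in> vfields A" and Y: "Y \<in> vfields A" and Z: "Z \<in> vfields A"
  shows "lie X (lie Y Z) = lie (lie X Y) Z + lie Y (lie X Z)"
  by (rule vfield_eqI)
    (simp add: vfact_lie vfact_add_left vfact_diff X Y Z smooth_vfact fun_eq_iff)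

section \<open>Endomorphism fields and additive maps\<close>

lemma vapp_closed: "K \<in> vforms A \<Longrightarrow> X \<in> vfields A \<Longrightarrow> vapp K X \<in> vfields A"
  by (simp add: vforms_def)

lemma vapp_add:
  "K \<in> vforms A \<Longrightarrow> X \<in> vfields A \<Longrightarrow> Y \<in> vfields A \<Longrightarrow>
    vapp K (X + Y) = vapp K X + vapp K Y"
  by (auto simp: vforms_def vapp_def fun_eq_iff vfields_tangent plus_fun_def)

text \<open>A template for maps that are additive only on the set \<open>vfields A\<close>. It is
  instantiated below in single arguments of \<open>D\<close>, \<open>lie\<close>,
  \<open>torsion D\<close>, \<open>curvature D\<close>, and for \<open>l\<close>, \<open>g\<close>
  and \<open>h\<close>.\<close>

lemma
  fixes f :: "'a vfield \<Rightarrow> 'c::ab_group_add"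
  assumes add: "\<And>X Y. X \<in> vfields A \<Longrightarrow> Y \<in> vfields A \<Longrightarrow> f (X + Y) = f X + f Y"
  shows additive_zero: "f 0 = 0"
    and additive_diff: "X \<in> vfields A \<Longrightarrow> Y \<in> vfields A \<Longrightarrow> f (X - Y) = f X - f Y"
    and additive_uminus: "X \<in> vfields A \<Longrightarrow> f (- X) = - f X"
proof -
  show 0: "f 0 = 0" using add[OF vfields_zero vfields_zero] by simp
  show d: "f (X - Y) = f X - f Y" if "X \<in> vfields A" "Y \<in> vfields A" for X Y
    using add[OF vfields_diff that(2), of X Y] that by (simp add: algebra_simps)
  show "f (- X) = - f X" if "X \<in> vfields A"
    using d[OF vfields_zero that] 0 by simp
qed

end

section \<open>Bianchi identities for a linear connection with torsion\<close>

lemma torsion_swap: "torsion D Y X = - torsion D X Y"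
  using lie_swap[of Y X] by (simp add: torsion_def)

locale smooth_linear_connection = smooth_manifold A
  for A :: "('a::{t2_space,second_countable_topology}, 'b::euclidean_space) atlas" +
  fixes D :: "'a lconn"
  assumes conn: "linear_connection A D"
begin

lemma D_closed: "X \<in> vfields A \<Longrightarrow> Y \<in> vfields A \<Longrightarrow> D X Y \<in> vfields A"
  and D_add_left: "X \<in> vfields A \<Longrightarrow> Y \<in> vfields A \<Longrightarrow> Z \<in> vfields A \<Longrightarrow> D (X + Y) Z = D X Z + D Y Z"
  and D_add: "X \<in> vfields A \<Longrightarrow> Y \<in> vfields A \<Longrightarrow> Z \<in> vfields A \<Longrightarrow> D X (Y + Z) = D X Y + D X Z"
  using conn by (auto simp: linear_connection_def)

lemmas D_zero_left = additive_zero[of "\<lambda>X. D X Z" for Z, OF D_add_left]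
lemmas D_zero = additive_zero[of "D X" for X, OF D_add]
lemmas D_diff = additive_diff[of "D X" for X, OF D_add]
lemmas D_uminus_left = additive_uminus[of "\<lambda>X. D X Z" for Z, OF D_add_left]
lemmas D_uminus = additive_uminus[of "D X" for X, OF D_add]

lemmas lie_diff_left = additive_diff[of "\<lambda>X. lie X Z" for Z, OF lie_add_left]

lemmas conn_closed = D_closed lie_closed vfields_zero vfields_add vfields_uminus vfields_diff

lemma torsion_closed: "X \<in> vfields A \<Longrightarrow> Y \<in> vfields A \<Longrightarrow> torsion D X Y \<in> vfields A"
  and curvature_closed: "X \<in> vfields A \<Longrightarrow> Y \<in> vfields A \<Longrightarrow> Z \<in> vfields A \<Longrightarrow>
    curvature D X Y Z \<in> vfields A"
  by (simp_all add: torsion_def curvature_def conn_closed)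

lemma torsion_add_left:
  "X \<in> vfields A \<Longrightarrow> Y \<in> vfields A \<Longrightarrow> Z \<in> vfields A \<Longrightarrow>
    torsion D (X + Y) Z = torsion D X Z + torsion D Y Z"
  by (simp add: torsion_def D_add D_add_left lie_add_left)

lemmas torsion_diff_left = additive_diff[of "\<lambda>X. torsion D X Z" for Z, OF torsion_add_left]
lemmas torsion_zero_left = additive_zero[of "\<lambda>X. torsion D X Z" for Z, OF torsion_add_left]

lemma curvature_swap:
  assumes "X \<in> vfields A" "Y \<in> vfields A" "Z \<in> vfields A"
  shows "curvature D Y X Z = - curvature D X Y Z"
  using assms lie_swap[of Y X] by (simp add: curvature_def D_uminus_left conn_closed)

lemma curvature_add_left:
  "X \<in> vfields A \<Longrightarrow> Y \<in> vfields A \<Longrightarrow> Z \<in> vfields A \<Longrightarrow> W \<in> vfields A \<Longrightarrow>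
    curvature D (X + Y) Z W = curvature D X Z W + curvature D Y Z W"
  by (simp add: curvature_def D_add D_add_left lie_add_left conn_closed)

lemmas curvature_diff_left =
  additive_diff[of "\<lambda>X. curvature D X Z W" for Z W, OF curvature_add_left]

lemmas curvature_zero_left =
  additive_zero[of "\<lambda>X. curvature D X Z W" for Z W, OF curvature_add_left]

text \<open>After expansion the second derivatives cancel and the Jacobi identity \<open>J\<close>
  for \<open>lie\<close> disposes of the rest. The last three lines are the covariant derivatives of
  the torsion, written out.\<close>

lemma first_Bianchi:
  assumes X: "X \<in> vfields A" and Y: "Y \<in> vfields A" and Z: "Z \<in> vfields A"
  shows "curvature D X Y Z + curvature D Y Z X + curvature D Z X Y =
      torsion D (torsion D X Y) Z + torsion D (torsion D Y Z) X + torsion D (torsion D Z X) Y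
      + (D X (torsion D Y Z) - torsion D (D X Y) Z - torsion D Y (D X Z))
      + (D Y (torsion D Z X) - torsion D (D Y Z) X - torsion D Z (D Y X))
      + (D Z (torsion D X Y) - torsion D (D Z X) Y - torsion D X (D Z Y))"
proof -
  have tt: "torsion D (torsion D U V) W
      = torsion D (D U V) W - torsion D (D V U) W - torsion D (lie U V) W"
    if "U \<in> vfields A" "V \<in> vfields A" "W \<in> vfields A" for U V W
    using that by (simp add: torsion_def[of D U V] torsion_diff_left conn_closed)
  have Dt: "D U (torsion D V W) = D U (D V W) - D U (D W V) - D U (lie V W)"
    if "U \<in> vfields A" "V \<in> vfields A" "W \<in> vfields A" for U V W
    using that by (simp add: torsion_def[of D V W] D_diff conn_closed)
  have lt: "torsion D (lie U V) W = D (lie U V) W - D W (lie U V) - lie (lie U V) W" for U V W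
    by (simp add: torsion_def)
  have J: "lie (lie X Y) Z + lie (lie Y Z) X + lie (lie Z X) Y = 0"
    using lie_Jacobi[OF X Y Z] lie_swap[of "lie Y Z" X] lie_swap[of "lie Z X" Y]
      lie_swap[of Z X] additive_uminus[of "lie Y", OF lie_add_right] X Y Z
    by (simp add: conn_closed)
  show ?thesis
    unfolding curvature_def tt[OF X Y Z] tt[OF Y Z X] tt[OF Z X Y] Dt[OF X Y Z] Dt[OF Y Z X]
      Dt[OF Z X Y] lt torsion_swap[of D Y "D X Z"] torsion_swap[of D Z "D Y X"]
      torsion_swap[of D X "D Z Y"]
    using J by (simp add: algebra_simps)
qed

text \<open>The triple derivatives of \<open>W\<close> cancel by the Jacobi identity for commutators
  of the operators \<open>D X\<close>, \<open>D Y\<close>, \<open>D Z\<close>; the derivatives along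
  double brackets cancel by the Jacobi identity for \<open>lie\<close>.\<close>

lemma second_Bianchi:
  assumes X: "X \<in> vfields A" and Y: "Y \<in> vfields A" and Z: "Z \<in> vfields A"
    and W: "W \<in> vfields A"
  shows "cov_deriv D X (curvature D) Y Z W + cov_deriv D Y (curvature D) Z X W
      + cov_deriv D Z (curvature D) X Y W
      + curvature D (torsion D X Y) Z W + curvature D (torsion D Y Z) X W
      + curvature D (torsion D Z X) Y W = 0"
proof -
  have tt: "curvature D (torsion D U V) U' W
      = curvature D (D U V) U' W - curvature D (D V U) U' W - curvature D (lie U V) U' W"
    if "U \<in> vfields A" "V \<in> vfields A" "U' \<in> vfields A" for U V U'
    using that W by (simp add: torsion_def curvature_diff_left conn_closed)
  have Dc: "D U (curvature D V U' W) = D U (D V (D U' W)) - D U (D U' (D V W)) - D U (D (lie V U') W)"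
    if "U \<in> vfields A" "V \<in> vfields A" "U' \<in> vfields A" for U V U'
    using that W by (simp add: curvature_def[of D V] D_diff conn_closed)
  have "D (lie (lie X Y) Z + lie (lie Y Z) X + lie (lie Z X) Y) W = 0"
    using lie_Jacobi[OF X Y Z] lie_swap[of "lie Y Z" X] lie_swap[of "lie Z X" Y]
      lie_swap[of Z X] additive_uminus[of "lie Y", OF lie_add_right] X Y Z W
    by (simp add: conn_closed D_zero_left)
  then have J: "D (lie (lie X Y) Z) W + D (lie (lie Y Z) X) W + D (lie (lie Z X) Y) W = 0"
    using X Y Z W by (simp add: conn_closed D_add_left)
  show ?thesis
    unfolding cov_deriv_def tt[OF X Y Z] tt[OF Y Z X] tt[OF Z X Y] Dc[OF X Y Z] Dc[OF Y Z X]
      Dc[OF Z X Y] curvature_swap[OF D_closed[OF X Z] Y W] curvature_swap[OF D_closed[OF Y X] Z W]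
      curvature_swap[OF D_closed[OF Z Y] X W]
      curvature_def[of D "lie U V" for U V] curvature_def[of D _ _ "D U V" for U V]
    using J by (simp add: algebra_simps)
qed

end

section \<open>The Berwald lift of a conservative connection\<close>

locale berwald_connection = smooth_manifold A
  for A :: "('a::{t2_space,second_countable_topology}, 'b::euclidean_space) atlas" +
  fixes n :: nat and L \<Gamma> F :: "'a vform" and C :: "'a vfield" and D :: "'a lconn"
  assumes L_struct: "L_structure A n L"
    and cons: "conservative A L C \<Gamma>"
    and acs: "associated_acs A L \<Gamma> F"
    and lift: "berwald_lift A L C \<Gamma> D"
begin

sublocale smooth_linear_connection A D
  using lift by unfold_locales
    (auto simp: berwald_lift_def reducible_L_lift_def L_lift_def L_normal_def L_almost_tangent_def)

abbreviation "V \<equiv> vfields A"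
abbreviation "l \<equiv> vapp L"
abbreviation "g \<equiv> vapp \<Gamma>"
abbreviation "h \<equiv> vapp (hproj \<Gamma>)"
abbreviation "T \<equiv> torsion D"

section \<open>Algebra of \<open>L\<close>, \<Gamma>, \<open>h\<close> and \<open>F\<close>\<close>

lemma forms: "L \<in> vforms A" "\<Gamma> \<in> vforms A" "F \<in> vforms A"
  using L_struct cons acs
  by (auto simp: L_structure_def conservative_def L_connection_def associated_acs_def)

lemma h_eq: "h X = fscale (\<lambda>_. 1/2) (X + g X)"
  by (simp add: vapp_def hproj_def fscale_def fun_eq_iff tscale_def)

lemma h_double: "h X + h X = X + g X"
  by (simp add: h_eq fscale_def tscale_def fun_eq_iff)

lemma l_closed: "X \<in> V \<Longrightarrow> l X \<in> V"
  and g_closed: "X \<in> V \<Longrightarrow> g X \<in> V"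
  and F_closed: "X \<in> V \<Longrightarrow> vapp F X \<in> V"
  by (simp_all add: vapp_closed forms)

lemma h_closed: "X \<in> V \<Longrightarrow> h X \<in> V"
  by (simp add: h_eq vfields_scale g_closed conn_closed)

lemmas field_closed = conn_closed torsion_closed curvature_closed l_closed g_closed F_closed h_closed

lemmas l_add = vapp_add[OF forms(1)]
lemmas l_diff = additive_diff[of l, OF l_add]
lemmas l_zero = additive_zero[of l, OF l_add]
lemmas g_add = vapp_add[OF forms(2)]
lemmas g_diff = additive_diff[of g, OF g_add]

lemma h_add: "X \<in> V \<Longrightarrow> Y \<in> V \<Longrightarrow> h (X + Y) = h X + h Y"
  by (simp add: h_eq g_add fscale_def tscale_def fun_eq_iff algebra_simps)

lemmas h_diff = additive_diff[of h, OF h_add]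

lemma gl: "X \<in> V \<Longrightarrow> g (l X) = - l X"
  and lg: "X \<in> V \<Longrightarrow> l (g X) = l X"
  using cons by (auto simp: conservative_def L_connection_def vapp_def fun_eq_iff vfields_tangent)

lemma ll: "X \<in> V \<Longrightarrow> l (l X) = 0"
  using L_struct by (fastforce simp: L_structure_def vapp_def fun_eq_iff dest: vfields_tangent)

text \<open>Pointwise a vertical vector is L w, and L F L w = L h w = L w. The use of
  \<open>F\<close> provides a smooth preimage, so facts about fields \<open>l Y\<close> extend to
  all vertical fields.\<close>

lemma lF:
  assumes "X \<in> V" "l X = 0"
  shows "l (vapp F X) = X"
proof
  fix p
  have "X p \<in> {v \<in> tangent A p. L p v = 0}"
    using assms by (auto simp: vfields_tangent vapp_def fun_eq_iff)
  moreover have "L p ` tangent A p = {v \<in> tangent A p. L p v = 0}"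
    using L_struct by (simp only: L_structure_def)
  ultimately obtain w where w: "w \<in> tangent A p" "X p = L p w"
    by blast
  have "L p (hproj \<Gamma> p w) = tscale (1/2) (L p w + L p (\<Gamma> p w))"
    using forms w by (simp add: hproj_def vforms_def tangent_add)
  also have "\<dots> = L p w"
    using cons w by (simp add: conservative_def L_connection_def tscale_def fun_eq_iff)
  finally show "l (vapp F X) p = X p"
    using acs w by (simp add: vapp_def associated_acs_def)
qed

text \<open>\<open>g X - X\<close> is killed by \<open>l\<close>, hence lies in the image of
  \<open>l\<close> by \<open>lF\<close>, where \<open>g\<close> acts as -1.\<close>

lemma gg:
  assumes "X \<in> V"
  shows "g (g X) = X"
proof -
  have "g X - X = l (vapp F (g X - X))"
    using assms by (intro lF[symmetric]) (simp_all add: field_closed l_diff lg)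
  then have "g (g X - X) = - (g X - X)"
    using gl[of "vapp F (g X - X)"] assms by (simp add: field_closed)
  then show ?thesis using assms by (simp add: g_diff field_closed)
qed

lemma lh: "X \<in> V \<Longrightarrow> l (h X) = l X"
  by (rule vfield_double_cancel)
    (simp only: l_add[symmetric] h_closed h_double, simp only: l_add lg g_closed)

lemma hl: "X \<in> V \<Longrightarrow> h (l X) = 0"
  by (rule vfield_double_cancel) (simp add: h_double gl)

lemma gh: "X \<in> V \<Longrightarrow> g (h X) = h X"
  by (rule vfield_double_cancel)
    (simp only: g_add[symmetric] h_closed h_double, simp only: g_add gg g_closed add.commute)

lemma hh: "X \<in> V \<Longrightarrow> h (h X) = h X"
  by (rule vfield_double_cancel) (simp add: h_double gh)

lemma h_vertical: "X \<in> V \<Longrightarrow> l X = 0 \<Longrightarrow> h X = 0"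
  using lF[of X] hl[of "vapp F X"] by (simp add: field_closed)

section \<open>Torsion of the Berwald lift and its relation to \<Omega>\<close>

lemma D_l: "X \<in> V \<Longrightarrow> Y \<in> V \<Longrightarrow> D X (l Y) = l (D X Y)"
  and D_g: "X \<in> V \<Longrightarrow> Y \<in> V \<Longrightarrow> D X (g Y) = g (D X Y)"
  and T_l_left: "X \<in> V \<Longrightarrow> Y \<in> V \<Longrightarrow> T (l X) Y = 0"
  using lift
  by (simp_all add: berwald_lift_def reducible_L_lift_def L_lift_def L_normal_def
      L_almost_tangent_def)

lemma D_h: "X \<in> V \<Longrightarrow> Y \<in> V \<Longrightarrow> D X (h Y) = h (D X Y)"
  by (rule vfield_double_cancel)
    (simp add: D_add[symmetric] field_closed h_double, simp add: D_add D_g field_closed)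

lemma T_l_right: "X \<in> V \<Longrightarrow> Y \<in> V \<Longrightarrow> T Y (l X) = 0"
  using T_l_left[of X Y] torsion_swap[of D "l X" Y] by simp

lemma T_vertical_left: "X \<in> V \<Longrightarrow> l X = 0 \<Longrightarrow> Y \<in> V \<Longrightarrow> T X Y = 0"
  using T_l_left[of "vapp F X" Y] by (simp add: lF field_closed)

text \<open>The terms of [L, L] = 0 come in equal pairs, and those containing L^2 vanish.\<close>

lemma lie_l:
  assumes "X \<in> V" "Y \<in> V"
  shows "lie (l X) (l Y) = l (lie (l X) Y) + l (lie X (l Y))"
proof (rule vfield_double_cancel)
  have "fn11 L L X Y = 0" using L_struct assms by (simp add: L_structure_def)
  then show "lie (l X) (l Y) + lie (l X) (l Y)
      = l (lie (l X) Y) + l (lie X (l Y)) + (l (lie (l X) Y) + l (lie X (l Y)))"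
    using assms by (simp add: fn11_def ll field_closed algebra_simps)
qed

text \<open>\<open>[L, \<Gamma>] = [L, [L, S]] = 0\<close>, by applying the derivation \<open>[S, _]\<close> to \<open>[L, L] = 0\<close>.\<close>

lemma L_bracket_Gamma:
  assumes X: "X \<in> V" and Y: "Y \<in> V"
  shows "lie (l X) (g Y) + lie (g X) (l Y) - l (lie (g X) Y) - g (lie (l X) Y)
    - l (lie X (g Y)) - g (lie X (l Y)) = 0"
proof -
  obtain S where S: "S \<in> V" and gS: "\<And>Y. Y \<in> V \<Longrightarrow> g Y = l (lie S Y) - lie S (l Y)"
    using cons by (auto simp: conservative_def L_spray_def fn10_def fn01_def)
  note ld = additive_diff[of "lie U" for U, OF lie_add_right]
  have "lie (lie S (l X)) (l Y) + lie (l X) (lie S (l Y))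
      = lie S (l (lie (l X) Y)) + lie S (l (lie X (l Y)))"
    using X Y S lie_Jacobi[of S "l X" "l Y"] by (simp add: lie_l field_closed lie_add_right)
  then show ?thesis
    using X Y S
    by (simp add: gS field_closed lie_diff_left ld lie_Jacobi[OF S] l_add l_diff lie_l algebra_simps)
qed

text \<open>Vanishing mixed torsion gives [hX, LY] = D_{hX}(LY) - D_{LY}(hX). Since \<open>D\<close>
  preserves both subbundles, this is the splitting into vertical and horizontal parts.\<close>

lemma D_horizontal_l:
  assumes X: "X \<in> V" and Y: "Y \<in> V"
  shows "D (h X) (l Y) = lie (h X) (l Y) - h (lie (h X) (l Y))"
proof -
  have e: "lie (h X) (l Y) = D (h X) (l Y) - D (l Y) (h X)"
    using T_l_right[OF Y h_closed[OF X]] by (simp add: torsion_def)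
  have "h (D (h X) (l Y)) = 0" "h (D (l Y) (h X)) = D (l Y) (h X)"
    using X Y by (simp_all add: D_l D_h hl hh field_closed)
  then show ?thesis using X Y by (simp add: e h_diff field_closed)
qed

text \<open>Twice the left side is [L, \<Gamma>](hX, hY), in which L\<Gamma> + \<Gamma>L = 0 has
  removed two terms and \<Gamma> fixes \<open>h X\<close> and \<open>h Y\<close>.\<close>

lemma l_torsion_horizontal:
  assumes X: "X \<in> V" and Y: "Y \<in> V"
  shows "l (T (h X) (h Y)) = 0"
proof (rule vfield_double_cancel)
  \<comment> \<open>Chosen so that D_{hX}(LY) - D_{hY}(LX) = E - hE by
    \<open>D_horizontal_l\<close>; the second bracket is reversed to absorb the minus sign.\<close>
  define E where "E = lie (h X) (l Y) + lie (l X) (h Y)"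
  have E: "E \<in> V" using X Y by (simp add: E_def field_closed)
  have h': "h (lie (h Y) (l X)) = - h (lie (l X) (h Y))"
    using lie_swap[of "h Y" "l X"] additive_uminus[of h, OF h_add] X Y by (simp add: field_closed)
  have "l (T (h X) (h Y)) = D (h X) (l Y) - D (h Y) (l X) - l (lie (h X) (h Y))"
    using X Y by (simp add: torsion_def l_diff field_closed lh D_l[symmetric] del: D_l)
  also have "\<dots> = E - h E - l (lie (h X) (h Y))"
    using X Y h' lie_swap[of "h Y" "l X"] by (simp add: D_horizontal_l E_def h_add field_closed)
  finally have "l (T (h X) (h Y)) + l (T (h X) (h Y))
      = E + E - (h E + h E) - (l (lie (h X) (h Y)) + l (lie (h X) (h Y)))"
    by simp
  also have "\<dots> = E - g E - l (lie (h X) (h Y)) - l (lie (h X) (h Y))"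
    unfolding h_double by simp
  also have "\<dots> = lie (l X) (h Y) + lie (h X) (l Y) - l (lie (h X) (h Y))
      - g (lie (l X) (h Y)) - l (lie (h X) (h Y)) - g (lie (h X) (l Y))"
    using X Y by (simp add: E_def g_add field_closed)
  also have "\<dots> = 0"
    using L_bracket_Gamma[OF h_closed[OF X] h_closed[OF Y]] X Y by (simp only: gh lh)
  finally show "l (T (h X) (h Y)) + l (T (h X) (h Y)) = 0 + 0" by simp
qed

lemma l_minus_h: "X \<in> V \<Longrightarrow> l (X - h X) = 0"
  by (simp add: l_diff lh field_closed)

text \<open>Both sides equal minus the vertical part of [hX, hY].\<close>

lemma Omega_eq_torsion:
  assumes X: "X \<in> V" and Y: "Y \<in> V"
  shows "conn_curvature \<Gamma> X Y = T (h X) (h Y)"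
proof -
  define U W where "U = X - h X" and "W = Y - h Y"
  have UW: "U \<in> V" "W \<in> V" "l U = 0" "l W = 0" "X = h X + U" "Y = h Y + W"
    using X Y by (simp_all add: U_def W_def field_closed l_minus_h)
  \<comment> \<open>Involutivity of the vertical bundle: \<open>lie_l\<close> applied to the
    preimages of \<open>U\<close> and \<open>W\<close> under \<open>l\<close>.\<close>
  have "lie U W = l (lie U (vapp F W)) + l (lie (vapp F U) W)"
    using lie_l[of "vapp F U" "vapp F W"] UW by (simp add: lF field_closed)
  then have v: "h (lie U W) = 0"
    using UW by (simp add: h_add hl field_closed)
  have "h (h (lie X Y)) = h (lie (h X) (h Y) + lie U (h Y) + (lie (h X) W + lie U W))"
    using X Y UW(1,2) UW(5,6)[symmetric]
      lie_add_left[of "h X" U Y] lie_add_right[of "h X" "h Y" W] lie_add_right[of U "h Y" W]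
    by (simp add: hh field_closed add_ac)
  also have "\<dots> = h (lie (h X) (h Y)) + h (lie U (h Y)) + h (lie (h X) W)"
    using X Y UW(1,2) v by (simp add: h_add field_closed)
  finally have 1: "h (h (lie X Y)) = h (lie (h X) (h Y)) + h (lie U (h Y)) + h (lie (h X) W)" .
  have 2: "h (lie X (h Y)) = h (lie (h X) (h Y)) + h (lie U (h Y))"
    "h (lie (h X) Y) = h (lie (h X) (h Y)) + h (lie (h X) W)"
    using X Y UW(1,2) UW(5,6)[symmetric]
      lie_add_left[of "h X" U "h Y"] lie_add_right[of "h X" "h Y" W]
    by (simp_all add: h_add[symmetric] field_closed)
  have "h (T (h X) (h Y)) = 0"
    using X Y by (simp add: h_vertical l_torsion_horizontal field_closed)
  \<comment> \<open>Derivatives of horizontal fields are horizontal, so only the bracket contributes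
    to the vertical part.\<close>
  moreover have "T (h X) (h Y) - h (T (h X) (h Y)) = h (lie (h X) (h Y)) - lie (h X) (h Y)"
    using X Y by (simp add: torsion_def h_diff D_h hh field_closed)
  ultimately have t: "T (h X) (h Y) = h (lie (h X) (h Y)) - lie (h X) (h Y)"
    by simp
  have "fn11 (hproj \<Gamma>) (hproj \<Gamma>) X Y = - (T (h X) (h Y) + T (h X) (h Y))"
    using X Y unfolding fn11_def 1 2 t by simp
  then show ?thesis
    by (simp add: conn_curvature_def fscale_def tscale_def fun_eq_iff)
qed

section \<open>Curvature on horizontal and vertical arguments: (a) and (e)\<close>

lemma curvature_l:
  "X \<in> V \<Longrightarrow> Y \<in> V \<Longrightarrow> Z \<in> V \<Longrightarrow> curvature D X Y (l Z) = l (curvature D X Y Z)"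
  by (simp add: curvature_def D_l l_diff field_closed)

lemma curvature_h:
  "X \<in> V \<Longrightarrow> Y \<in> V \<Longrightarrow> Z \<in> V \<Longrightarrow> curvature D X Y (h Z) = h (curvature D X Y Z)"
  by (simp add: curvature_def D_h h_diff field_closed)

text \<open>This turns the horizontal last arguments in the first Bianchi identity into the vertical
  ones in the definitions of \<open>R_tensor\<close> and \<open>P_tensor\<close>.\<close>

lemma l_curvature_h:
  "X \<in> V \<Longrightarrow> Y \<in> V \<Longrightarrow> Z \<in> V \<Longrightarrow> l (curvature D X Y (h Z)) = curvature D X Y (l Z)"
  by (simp add: curvature_l curvature_h lh field_closed)

text \<open>\<open>D\<close> keeps vertical fields vertical, so every torsion in the first Bianchi
  identity has a vertical argument and vanishes.\<close>

lemma Bianchi_hll: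
  assumes "X \<in> V" "Y \<in> V" "Z \<in> V"
  shows "curvature D (h X) (l Y) (l Z) + curvature D (l Y) (l Z) (h X)
    + curvature D (l Z) (h X) (l Y) = 0"
  using first_Bianchi[of "h X" "l Y" "l Z"] assms
  by (simp add: field_closed T_l_left T_l_right D_l D_zero torsion_zero_left)

text \<open>Under \<open>l\<close> the two terms of \<open>Bianchi_hll\<close> that act on a
  vertical field vanish because L^2 = 0; the remaining one is the claim.\<close>

lemma curvature_ll:
  assumes "X \<in> V" "Y \<in> V" "Z \<in> V"
  shows "curvature D (l X) (l Y) (l Z) = 0"
proof -
  have "l (curvature D (h Z) (l X) (l Y) + curvature D (l X) (l Y) (h Z)
    + curvature D (l Y) (h Z) (l X)) = 0"
    using Bianchi_hll[of Z X Y] assms by (simp add: l_zero)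
  then show ?thesis
    using assms by (simp add: l_add l_curvature_h curvature_l ll field_closed)
qed

lemma P_swap_last:
  assumes "X \<in> V" "Y \<in> V" "Z \<in> V"
  shows "P_tensor L \<Gamma> D X Y Z = P_tensor L \<Gamma> D X Z Y"
proof -
  \<comment> \<open>The field inside \<open>h\<close> is vertical by \<open>curvature_ll\<close>. So
    the middle term of \<open>Bianchi_hll\<close> drops out, leaving two values of
    \<open>P_tensor\<close>.\<close>
  have "curvature D (l Y) (l Z) (h X) = h (curvature D (l Y) (l Z) X)"
    using assms by (simp add: curvature_h field_closed)
  also have "\<dots> = 0"
    using assms curvature_ll[of Y Z X] by (intro h_vertical) (simp_all add: field_closed curvature_l)
  finally show ?thesis
    using Bianchi_hll[of X Y Z] curvature_swap[of "h X" "l Z" "l Y"] assms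
    by (simp add: P_tensor_def field_closed)
qed

lemma P_swap_outer:
  assumes "X \<in> V" "Y \<in> V" "Z \<in> V"
  shows "P_tensor L \<Gamma> D X Y Z = P_tensor L \<Gamma> D Z Y X"
proof -
  have "curvature D (h X) (h Z) (l Y) + curvature D (h Z) (l Y) (h X) + curvature D (l Y) (h X) (h Z)
      = D (l Y) (T (h X) (h Z)) - T (h (D (l Y) X)) (h Z) - T (h X) (h (D (l Y) Z))"
    using first_Bianchi[of "h X" "h Z" "l Y"] assms
    by (simp add: field_closed T_l_left T_l_right T_vertical_left l_torsion_horizontal D_l D_h D_zero
        torsion_zero_left)
  \<comment> \<open>\<open>l\<close> kills the right side, which is vertical, and the term acting on
    \<open>l Y\<close>. The other two become values of \<open>P_tensor\<close>, with opposite
    signs.\<close>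
  from arg_cong[OF this, of l] show ?thesis
    using assms curvature_swap[of "h X" "l Y" "l Z"]
    by (simp add: l_add l_diff field_closed l_curvature_h l_torsion_horizontal D_l[symmetric] D_zero
        curvature_l ll P_tensor_def del: D_l)
qed

lemma P_symmetric:
  assumes "X \<in> V" "Y \<in> V" "Z \<in> V"
  shows "P_tensor L \<Gamma> D X Y Z = P_tensor L \<Gamma> D Y X Z"
    and "P_tensor L \<Gamma> D Y X Z = P_tensor L \<Gamma> D Z X Y"
  using assms P_swap_last P_swap_outer by metis+

text \<open>The torsion of horizontal fields is vertical: nested torsions vanish, and
  \<open>l\<close> kills the remaining torsion terms.\<close>

lemma R_cyclic:
  assumes "X \<in> V" "Y \<in> V" "Z \<in> V"
  shows "R_tensor L \<Gamma> D X Y Z + R_tensor L \<Gamma> D Y Z X + R_tensor L \<Gamma> D Z X Y = 0"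
proof -
  have "curvature D (h X) (h Y) (h Z) + curvature D (h Y) (h Z) (h X) + curvature D (h Z) (h X) (h Y)
     = (D (h X) (T (h Y) (h Z)) - T (h (D (h X) Y)) (h Z) - T (h Y) (h (D (h X) Z)))
      + (D (h Y) (T (h Z) (h X)) - T (h (D (h Y) Z)) (h X) - T (h Z) (h (D (h Y) X)))
      + (D (h Z) (T (h X) (h Y)) - T (h (D (h Z) X)) (h Y) - T (h X) (h (D (h Z) Y)))"
    using first_Bianchi[of "h X" "h Y" "h Z"] assms
    by (simp add: field_closed T_vertical_left l_torsion_horizontal D_h)
  from arg_cong[OF this, of l] show ?thesis
    using assms
    by (simp add: l_add l_diff field_closed l_curvature_h l_torsion_horizontal D_l[symmetric] D_zero
        R_tensor_def del: D_l)
qed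

section \<open>Second Bianchi identity: (b), (c) and (d)\<close>

text \<open>\<open>D\<close> commutes with \<open>h\<close> and \<open>l\<close>, so inserting them
  in the arguments commutes with covariant differentiation.\<close>

lemma cov_deriv_R:
  "U \<in> V \<Longrightarrow> X \<in> V \<Longrightarrow> Y \<in> V \<Longrightarrow> W \<in> V \<Longrightarrow>
    cov_deriv D U (R_tensor L \<Gamma> D) X Y W = cov_deriv D U (curvature D) (h X) (h Y) (l W)"
  and cov_deriv_P:
  "U \<in> V \<Longrightarrow> X \<in> V \<Longrightarrow> Y \<in> V \<Longrightarrow> W \<in> V \<Longrightarrow>
    cov_deriv D U (P_tensor L \<Gamma> D) X Y W = cov_deriv D U (curvature D) (h X) (l Y) (l W)"
  by (simp_all add: cov_deriv_def R_tensor_def P_tensor_def D_l D_h)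

lemma cov_deriv_curvature_swap:
  assumes "U \<in> V" "X \<in> V" "Y \<in> V" "W \<in> V"
  shows "cov_deriv D U (curvature D) Y X W = - cov_deriv D U (curvature D) X Y W"
  using assms
  by (simp add: cov_deriv_def curvature_swap[of X Y] curvature_swap[of X "D U Y"]
      curvature_swap[of "D U X" Y] D_uminus field_closed algebra_simps)

lemma curvature_vertical:
  "X \<in> V \<Longrightarrow> l X = 0 \<Longrightarrow> Y \<in> V \<Longrightarrow> Z \<in> V \<Longrightarrow> curvature D X (l Y) (l Z) = 0"
  using curvature_ll[of "vapp F X" Y Z] by (simp add: lF field_closed)

text \<open>The torsion is \<Omega>(X, Y), a vertical field, hence L F \<Omega>(X, Y) by
  \<open>lF\<close>. Exchanging the first two curvature arguments gives the sign.\<close>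

lemma curvature_Omega:
  assumes "X \<in> V" "Y \<in> V" "Z \<in> V" "W \<in> V"
  shows "curvature D (T (h X) (h Y)) (h Z) (l W)
    = - P_tensor L \<Gamma> D Z (vapp F (conn_curvature \<Gamma> X Y)) W"
  using assms curvature_swap[of "h Z" "T (h X) (h Y)" "l W"]
  by (simp add: P_tensor_def Omega_eq_torsion lF l_torsion_horizontal field_closed)

lemma R_Bianchi:
  assumes "X \<in> V" "Y \<in> V" "Z \<in> V" "W \<in> V"
  shows "cov_deriv D (h X) (R_tensor L \<Gamma> D) Y Z W + cov_deriv D (h Y) (R_tensor L \<Gamma> D) Z X W
      + cov_deriv D (h Z) (R_tensor L \<Gamma> D) X Y W
    = P_tensor L \<Gamma> D X (vapp F (conn_curvature \<Gamma> Y Z)) W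
      + P_tensor L \<Gamma> D Y (vapp F (conn_curvature \<Gamma> Z X)) W
      + P_tensor L \<Gamma> D Z (vapp F (conn_curvature \<Gamma> X Y)) W"
  using second_Bianchi[of "h X" "h Y" "h Z" "l W"] assms
  by (simp add: cov_deriv_R curvature_Omega field_closed algebra_simps)

text \<open>Two torsion terms of the second Bianchi identity have the argument \<open>l Z\<close>;
  the third puts the vertical T(hX, hY) next to \<open>l Z\<close>, where the curvature is 0 on
  \<open>l W\<close>.\<close>

lemma R_vertical_derivative:
  assumes "X \<in> V" "Y \<in> V" "Z \<in> V" "W \<in> V"
  shows "cov_deriv D (l Z) (R_tensor L \<Gamma> D) X Y W
    = cov_deriv D (h Y) (P_tensor L \<Gamma> D) X Z W - cov_deriv D (h X) (P_tensor L \<Gamma> D) Y Z W"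
  using second_Bianchi[of "h X" "h Y" "l Z" "l W"] assms
    cov_deriv_curvature_swap[of "h Y" "h X" "l Z" "l W"]
  by (simp add: cov_deriv_R cov_deriv_P curvature_vertical l_torsion_horizontal T_l_left T_l_right
      curvature_zero_left field_closed algebra_simps)

lemma P_vertical_derivative:
  assumes "X \<in> V" "Y \<in> V" "Z \<in> V" "W \<in> V"
  shows "cov_deriv D (l Z) (P_tensor L \<Gamma> D) X Y W = cov_deriv D (l Y) (P_tensor L \<Gamma> D) X Z W"
proof -
  \<comment> \<open>\<open>curvature_ll\<close> survives differentiation because \<open>D\<close>
    sends \<open>l Y\<close> to \<open>l\<close> of a field. Only the two derivatives along
    \<open>l Y\<close> and \<open>l Z\<close> remain.\<close>
  have "cov_deriv D (h X) (curvature D) (l Y) (l Z) (l W) = 0"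
    using assms by (simp add: cov_deriv_def D_l curvature_ll D_zero field_closed)
  then show ?thesis
    using second_Bianchi[of "h X" "l Y" "l Z" "l W"] assms
      cov_deriv_curvature_swap[of "l Y" "h X" "l Z" "l W"]
    by (simp add: cov_deriv_P T_l_left T_l_right curvature_zero_left field_closed)
qed

end

theorem proposition4p8:
  fixes A :: "('a::{t2_space,second_countable_topology}, 'b::euclidean_space) atlas"
    and n :: nat
    and L \<Gamma> F :: "'a vform"
    and C :: "'a vfield"
    and D :: "'a lconn"
  assumes "smooth_atlas A"
    and "DIM('b) = 2 * n"
    and "L_structure A n L"
    and "canonical_field A L C"
    and "conservative A L C \<Gamma>"
    and "associated_acs A L \<Gamma> F"
    and "berwald_lift A L C \<Gamma> D"
  shows "let h = hproj \<Gamma>; \<Omega> = conn_curvature \<Gamma>; R = R_tensor L \<Gamma> D; P = P_tensor L \<Gamma> D in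
    \<forall>X\<in>vfields A. \<forall>Y\<in>vfields A. \<forall>Z\<in>vfields A.
      R X Y Z + R Y Z X + R Z X Y = 0 \<and>
      (\<forall>W\<in>vfields A.
        cov_deriv D (vapp h X) R Y Z W + cov_deriv D (vapp h Y) R Z X W
          + cov_deriv D (vapp h Z) R X Y W
        = P X (vapp F (\<Omega> Y Z)) W + P Y (vapp F (\<Omega> Z X)) W + P Z (vapp F (\<Omega> X Y)) W) \<and>
      (\<forall>W\<in>vfields A.
        cov_deriv D (vapp L Z) R X Y W
        = cov_deriv D (vapp h Y) P X Z W - cov_deriv D (vapp h X) P Y Z W) \<and>
      (\<forall>W\<in>vfields A.
        cov_deriv D (vapp L Z) P X Y W = cov_deriv D (vapp L Y) P X Z W) \<and>
      P X Y Z = P Y X Z \<and> P Y X Z = P Z X Y"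
proof -
  interpret berwald_connection A n L \<Gamma> F C D
    using assms by unfold_locales
  show ?thesis
    unfolding Let_def
    by (intro ballI conjI R_cyclic R_Bianchi R_vertical_derivative P_vertical_derivative P_symmetric)
qed

end
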